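(* Consider a security game with homogeneous resources that can cover any single target. If $U_a^c(t_i)\ne E^*$ for every target $t_i\in T$, then the defender has a unique minimax strategy, a unique Nash equilibrium strategy, and a unique Strong Stackelberg Equilibrium strategy, and these three strategies are the same (defender strategies being represented by their vectors of marginal coverage probabilities).
   Context: The game is played between a defender and an attacker. There are a finite nonempty set of targets $T=\{t_1,\dots,t_n\}$ and $K$ identical defender resources, each of which can cover any single target (or remain unused). For each target $t$ there are real payoffs $U_d^c(t),U_d^u(t)$ (defender, $t$ attacked while covered/uncovered) and $U_a^c(t),U_a^u(t)$ (attacker), with $\Delta U_d(t):=U_d^c(t)-U_d^u(t)>0$ and $\Delta U_a(t):=U_a^u(t)-U_a^c(t)>0$. A mixed strategy of the defender (a distribution over assignments of resources to targets) affects utilities only through its vector $\mathbf{c}=(c_i)$ of marginal coverage probabilities; the feasible vectors are exactly those $\mathbf{c}\in[0,1]^n$ with $\sum_{i=1}^n c_i\le K$. Defender strategies are identified with such vectors. An attacker strategy $\mathbf{a}=(a_i)$ is a probability distribution on $T$. Utilities are $$U_d(\mathbf{c},\mathbf{a})=\sum_{i=1}^n a_i\big(c_iU_d^c(t_i)+(1-c_i)U_d^u(t_i)\big),\qquad U_a(\mathbf{c},\mathbf{a})=\sum_{i=1}^n a_i\big(c_iU_a^c(t_i)+(1-c_i)U_a^u(t_i)\big),$$ and $U_a(\mathbf{c},t_i)$ denotes the attacker's utility of attacking $t_i$ with probability 1. Let $E(\mathbf{c})=\max_i U_a(\mathbf{c},t_i)$ and $E^*=\min_{\mathbf{c}}E(\mathbf{c})$.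 A minimax strategy of the defender is $\mathbf{c}$ with $E(\mathbf{c})=E^*$. A Nash equilibrium is $\langle\mathbf{c},\mathbf{a}\rangle$ with each strategy a best response to the other. A Strong Stackelberg Equilibrium is a pair $\langle\mathbf{c},g\rangle$, where $g$ maps defender strategies to attacker strategies, such that (1) $U_d(\mathbf{c},g(\mathbf{c}))\ge U_d(\mathbf{c}',g(\mathbf{c}'))$ for all $\mathbf{c}'$; (2) for every $\mathbf{c}'$, $g(\mathbf{c}')$ is an attacker best response to $\mathbf{c}'$; (3) for every $\mathbf{c}'$ and every attacker best response $\mathbf{a}$ to $\mathbf{c}'$, $U_d(\mathbf{c}',g(\mathbf{c}'))\ge U_d(\mathbf{c}',\mathbf{a})$. A defender NE (resp. SSE) strategy is the defender component of some Nash equilibrium (resp. Strong Stackelberg Equilibrium). *)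

theory Defs
  imports "HOL-Analysis.Analysis"
begin

text \<open>
  The targets are the elements of a finite type \<open>'t\<close>.  Strategies of either player are
  vectors indexed by the targets: marginal coverage probabilities for the defender,
  attack probabilities for the attacker.
\<close>

record 't game =
  resources :: nat
  def_cov :: "'t \<Rightarrow> real"
  def_unc :: "'t \<Rightarrow> real"
  att_cov :: "'t \<Rightarrow> real"
  att_unc :: "'t \<Rightarrow> real"

definition security_game :: "'t::finite game \<Rightarrow> bool" where
  "security_game G \<longleftrightarrow>
     (\<forall>t. def_cov G t - def_unc G t > 0) \<and> (\<forall>t. att_unc G t - att_cov G t > 0)"

definition defender_strategies :: "'t::finite game \<Rightarrow> (real ^ 't) set" where
  "defender_strategies G =
     {c. (\<forall>t. 0 \<le> c $ t \<and> c $ t \<le> 1) \<and> (\<Sum>t\<in>UNIV. c $ t) \<le> real (resources G)}"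

definition attacker_strategies :: "(real ^ 't::finite) set" where
  "attacker_strategies = {a. (\<forall>t. 0 \<le> a $ t) \<and> (\<Sum>t\<in>UNIV. a $ t) = 1}"

definition U_d :: "'t::finite game \<Rightarrow> real ^ 't \<Rightarrow> real ^ 't \<Rightarrow> real" where
  "U_d G c a = (\<Sum>t\<in>UNIV. a $ t * (c $ t * def_cov G t + (1 - c $ t) * def_unc G t))"

definition U_a :: "'t::finite game \<Rightarrow> real ^ 't \<Rightarrow> real ^ 't \<Rightarrow> real" where
  "U_a G c a = (\<Sum>t\<in>UNIV. a $ t * (c $ t * att_cov G t + (1 - c $ t) * att_unc G t))"

text \<open>The unit vector \<open>axis t 1\<close> is the attacker strategy of attacking \<open>t\<close> with probability 1.\<close>

definition E :: "'t::finite game \<Rightarrow> real ^ 't \<Rightarrow> real" where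
  "E G c = (MAX t. U_a G c (axis t 1))"

text \<open>The infimum is attained (lemma \<open>E_star_attained\<close> below), so it is a minimum.\<close>

definition E_star :: "'t::finite game \<Rightarrow> real" where
  "E_star G = (INF c\<in>defender_strategies G. E G c)"

definition minimax_strategy :: "'t::finite game \<Rightarrow> real ^ 't \<Rightarrow> bool" where
  "minimax_strategy G c \<longleftrightarrow> c \<in> defender_strategies G \<and> E G c = E_star G"

definition attacker_best_response :: "'t::finite game \<Rightarrow> real ^ 't \<Rightarrow> real ^ 't \<Rightarrow> bool" where
  "attacker_best_response G c a \<longleftrightarrow>
     a \<in> attacker_strategies \<and> (\<forall>a'\<in>attacker_strategies. U_a G c a' \<le> U_a G c a)"

definition defender_best_response :: "'t::finite game \<Rightarrow> real ^ 't \<Rightarrow> real ^ 't \<Rightarrow> bool" where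
  "defender_best_response G a c \<longleftrightarrow>
     c \<in> defender_strategies G \<and> (\<forall>c'\<in>defender_strategies G. U_d G c' a \<le> U_d G c a)"

definition nash_equilibrium :: "'t::finite game \<Rightarrow> real ^ 't \<Rightarrow> real ^ 't \<Rightarrow> bool" where
  "nash_equilibrium G c a \<longleftrightarrow> defender_best_response G a c \<and> attacker_best_response G c a"

text \<open>
  The values of the response function \<open>g\<close> outside of \<^term>\<open>defender_strategies G\<close> are irrelevant.
\<close>

definition strong_stackelberg_equilibrium ::
    "'t::finite game \<Rightarrow> real ^ 't \<Rightarrow> (real ^ 't \<Rightarrow> real ^ 't) \<Rightarrow> bool" where
  "strong_stackelberg_equilibrium G c g \<longleftrightarrow>
     c \<in> defender_strategies G \<and>
     (\<forall>c'\<in>defender_strategies G. U_d G c (g c) \<ge> U_d G c' (g c')) \<and>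
     (\<forall>c'\<in>defender_strategies G. attacker_best_response G c' (g c')) \<and>
     (\<forall>c'\<in>defender_strategies G. \<forall>a.
        attacker_best_response G c' a \<longrightarrow> U_d G c' (g c') \<ge> U_d G c' a)"

definition defender_NE_strategy :: "'t::finite game \<Rightarrow> real ^ 't \<Rightarrow> bool" where
  "defender_NE_strategy G c \<longleftrightarrow> (\<exists>a. nash_equilibrium G c a)"

definition defender_SSE_strategy :: "'t::finite game \<Rightarrow> real ^ 't \<Rightarrow> bool" where
  "defender_SSE_strategy G c \<longleftrightarrow> (\<exists>g. strong_stackelberg_equilibrium G c g)"

lemma U_a_axis:
  "U_a G c (axis t 1) = c $ t * att_cov G t + (1 - c $ t) * att_unc G t"
proof -
  have "U_a G c (axis t 1) =
      (\<Sum>s\<in>UNIV. if s = t then c $ s * att_cov G s + (1 - c $ s) * att_unc G s else 0)"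
    unfolding U_a_def by (rule sum.cong) (auto simp: axis_def)
  then show ?thesis by simp
qed

lemma continuous_on_Max_image:
  fixes f :: "'i \<Rightarrow> 'a::topological_space \<Rightarrow> real"
  assumes "finite I" "I \<noteq> {}" "\<And>i. i \<in> I \<Longrightarrow> continuous_on S (f i)"
  shows "continuous_on S (\<lambda>x. Max ((\<lambda>i. f i x) ` I))"
  using assms
proof (induction I rule: finite_ne_induct)
  case (insert i I)
  have "Max ((\<lambda>j. f j x) ` insert i I) = max (f i x) (Max ((\<lambda>j. f j x) ` I))" for x
    using insert.hyps by simp
  with insert show ?case by (simp add: continuous_on_max)
qed simp

lemma continuous_on_E: "continuous_on S (E G)"
  unfolding E_def [abs_def]
  by (rule continuous_on_Max_image) (auto simp: U_a_axis intro!: continuous_intros)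

lemma compact_defender_strategies: "compact (defender_strategies G)"
proof -
  have "defender_strategies G =
      cbox 0 1 \<inter> {c. (\<Sum>t\<in>UNIV. c $ t) \<le> real (resources G)}"
    by (auto simp: defender_strategies_def mem_box_cart)
  moreover have "closed {c :: real ^ 'a. (\<Sum>t\<in>UNIV. c $ t) \<le> real (resources G)}"
    by (intro closed_Collect_le continuous_intros)
  ultimately show ?thesis by (simp add: compact_Int_closed)
qed

lemma zero_in_defender_strategies: "0 \<in> defender_strategies G"
  by (simp add: defender_strategies_def)

lemma E_star_attained:
  obtains c where "c \<in> defender_strategies G" "E G c = E_star G"
    "\<And>c'. c' \<in> defender_strategies G \<Longrightarrow> E_star G \<le> E G c'"
proof -
  obtain c where c: "c \<in> defender_strategies G" "\<forall>c'\<in>defender_strategies G. E G c \<le> E G c'"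
    using continuous_attains_inf [OF compact_defender_strategies _ continuous_on_E]
      zero_in_defender_strategies by blast
  then have "E_star G = E G c"
    unfolding E_star_def by (intro cInf_eq_minimum) auto
  with c that show thesis by auto
qed

end

theory Submission imports Defs begin

text \<open>
  If no \<^term>\<open>att_cov G t\<close> equals the minimax value, then a minimax strategy \<open>c\<close> leaves slack
  \<open>c $ t < 1\<close> everywhere, so it must use up all resources and spend none of them outside of the
  attack set (otherwise slightly more coverage on every target of the attack set would lower the
  value).  Any strategy \<open>c' \<noteq> c\<close> then has a larger attacker value, which means that every target
  attacked in response to \<open>c'\<close> is covered strictly less by \<open>c'\<close> than by \<open>c\<close>.  Hence an attacker
  best response to \<open>c'\<close> is also one to \<open>c\<close>, and gives the defender strictly more there; this
  excludes \<open>c'\<close> both as a Nash and as a Stackelberg strategy.  Conversely, attacking the targets \<open>t\<close>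
  of the attack set with probability proportional to \<open>1 / (def_cov G t - def_unc G t)\<close> makes the
  defender indifferent about how to distribute the resources over the attack set.
\<close>

section \<open>Attacker values and best responses\<close>

lemma U_a_axis_eq_diff: "U_a G c (axis t 1) = att_unc G t - c $ t * (att_unc G t - att_cov G t)"
  by (simp add: U_a_axis algebra_simps)

lemma U_a_eq_sum_axis: "U_a G c a = (\<Sum>t\<in>UNIV. a $ t * U_a G c (axis t 1))"
  unfolding U_a_axis by (simp add: U_a_def)

lemma axis_in_attacker_strategies: "axis t 1 \<in> attacker_strategies"
  by (auto simp: attacker_strategies_def axis_def)

lemma U_a_axis_le_E: "U_a G c (axis t 1) \<le> E G c"
  unfolding E_def by (rule Max_ge) auto

lemma E_attained: obtains t where "U_a G c (axis t 1) = E G c"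
proof -
  have "E G c \<in> range (\<lambda>t. U_a G c (axis t 1))"
    unfolding E_def by (rule Max_in) auto
  then show thesis using that by auto
qed

text \<open>The weights sum to 1, so \<open>E G c\<close> can be moved under the sum. The attacker's
  loss becomes a sum of nonnegative terms, which yields both the bound by \<open>E G c\<close> and
  the description of best responses by their support.\<close>

lemma E_minus_U_a:
  assumes "a \<in> attacker_strategies"
  shows "E G c - U_a G c a = (\<Sum>t\<in>UNIV. a $ t * (E G c - U_a G c (axis t 1)))"
proof -
  have "(\<Sum>t\<in>UNIV. a $ t * (E G c - U_a G c (axis t 1)))
      = (\<Sum>t\<in>UNIV. a $ t) * E G c - U_a G c a"
    unfolding U_a_eq_sum_axis [of G c a]
    by (simp add: sum_subtractf right_diff_distrib sum_distrib_right)
  with assms show ?thesis by (simp add: attacker_strategies_def)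
qed

lemma U_a_le_E: "a \<in> attacker_strategies \<Longrightarrow> U_a G c a \<le> E G c"
  using E_minus_U_a [of a G c] U_a_axis_le_E [of G c]
  by (smt (verit) attacker_strategies_def mem_Collect_eq mult_nonneg_nonneg sum_nonneg)

lemma attacker_best_response_iff_value:
  "attacker_best_response G c a \<longleftrightarrow> a \<in> attacker_strategies \<and> U_a G c a = E G c"
  unfolding attacker_best_response_def
  by (metis E_attained U_a_le_E axis_in_attacker_strategies order_antisym)

lemma attacker_best_response_iff_support:
  "attacker_best_response G c a \<longleftrightarrow>
    a \<in> attacker_strategies \<and> (\<forall>t. a $ t \<noteq> 0 \<longrightarrow> U_a G c (axis t 1) = E G c)"
proof (cases "a \<in> attacker_strategies")
  case True
  then have "0 \<le> a $ t * (E G c - U_a G c (axis t 1))" for t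
    using U_a_axis_le_E [of G c t] by (simp add: attacker_strategies_def)
  then have "E G c - U_a G c a = 0 \<longleftrightarrow> (\<forall>t. a $ t * (E G c - U_a G c (axis t 1)) = 0)"
    unfolding E_minus_U_a [OF True] by (subst sum_nonneg_eq_0_iff) auto
  with True show ?thesis unfolding attacker_best_response_iff_value by auto
qed (simp add: attacker_best_response_iff_value)

lemma U_d_diff:
  "U_d G c' a - U_d G c a = (\<Sum>t\<in>UNIV. a $ t * (c' $ t - c $ t) * (def_cov G t - def_unc G t))"
  unfolding U_d_def sum_subtractf [symmetric] by (rule sum.cong) (auto simp: algebra_simps)

lemma attacker_strategies_obtain_support:
  assumes "a \<in> attacker_strategies"
  obtains t where "a $ t > 0"
proof -
  have "\<exists>t. a $ t \<noteq> 0"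
  proof (rule ccontr)
    assume "\<not> ?thesis"
    then have "(\<Sum>t\<in>UNIV. a $ t) = 0" by simp
    with assms show False by (simp add: attacker_strategies_def)
  qed
  with assms that show thesis by (fastforce simp: attacker_strategies_def order_less_le)
qed

text \<open>Supplies the tie-breaking response of a Stackelberg equilibrium. A best response
  averages the defender's payoffs over the attack set \<open>M\<close>, so the pure attack on the
  target of \<open>M\<close> with the largest payoff \<open>d\<close> is optimal for the
  defender.\<close>

lemma exists_favourable_best_response:
  "\<exists>a. attacker_best_response G c a \<and> (\<forall>a'. attacker_best_response G c a' \<longrightarrow> U_d G c a' \<le> U_d G c a)"
proof -
  define d where "d t = c $ t * def_cov G t + (1 - c $ t) * def_unc G t" for t
  define M where "M = {t. U_a G c (axis t 1) = E G c}"
  have "M \<noteq> {}" using E_attained [of G c] by (auto simp: M_def)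
  then obtain s where s: "s \<in> M" and max: "\<And>t. t \<in> M \<Longrightarrow> d t \<le> d s"
    using obtains_MAX [of M d] Max_ge [of "d ` M"]
    by (metis finite finite_imageI imageI)
  have "U_d G c (axis s 1) = (\<Sum>t\<in>UNIV. if t = s then d t else 0)"
    unfolding U_d_def d_def by (rule sum.cong) (auto simp: axis_def)
  then have ds: "U_d G c (axis s 1) = d s" by simp
  have "U_d G c a' \<le> U_d G c (axis s 1)" if "attacker_best_response G c a'" for a'
  proof -
    have a': "\<And>t. 0 \<le> a' $ t" "(\<Sum>t\<in>UNIV. a' $ t) = 1" "\<And>t. a' $ t \<noteq> 0 \<Longrightarrow> t \<in> M"
      using that by (auto simp: attacker_best_response_iff_support attacker_strategies_def M_def)
    have "a' $ t * d t \<le> a' $ t * d s" for t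
      using a' max by (cases "a' $ t = 0") (auto intro: mult_left_mono)
    then have "U_d G c a' \<le> (\<Sum>t\<in>UNIV. a' $ t * d s)"
      unfolding U_d_def d_def [symmetric] by (rule sum_mono)
    also have "\<dots> = d s" using a'(2) by (simp flip: sum_distrib_right)
    finally show ?thesis by (simp add: ds)
  qed
  moreover have "attacker_best_response G c (axis s 1)"
    using s axis_in_attacker_strategies
    by (auto simp: attacker_best_response_iff_support M_def axis_def)
  ultimately show ?thesis by blast
qed

section \<open>The minimax strategy in closed form\<close>

lemma E_star_le: "c \<in> defender_strategies G \<Longrightarrow> E_star G \<le> E G c"
  using E_star_attained by metis

lemma exists_strictly_larger_strategy:
  assumes c: "c \<in> defender_strategies G" "\<And>t. c $ t < 1"
    and "(\<Sum>t\<in>UNIV. c $ t) < real (resources G)"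
  obtains c' where "c' \<in> defender_strategies G" "\<And>t. c $ t < c' $ t"
proof
  define n where "n = real CARD('a)"
  define \<epsilon> where "\<epsilon> = min ((real (resources G) - (\<Sum>t\<in>UNIV. c $ t)) / n) (MIN t. 1 - c $ t)"
  have n: "n > 0" by (simp add: n_def)
  have m: "(MIN t. 1 - c $ t) > 0" using c(2) by (subst Min_gr_iff) auto
  show "c $ t < (\<chi> t. c $ t + \<epsilon>) $ t" for t
    using m n assms(3) by (simp add: \<epsilon>_def)
  have pos: "\<epsilon> > 0" using m n assms(3) by (simp add: \<epsilon>_def)
  have "\<epsilon> \<le> 1 - c $ t" for t
    unfolding \<epsilon>_def by (rule min.coboundedI2, rule Min_le) auto
  then have "c $ t + \<epsilon> \<le> 1" for t by (smt (verit))
  moreover have "\<epsilon> \<le> (real (resources G) - (\<Sum>t\<in>UNIV. c $ t)) / n" by (simp add: \<epsilon>_def)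
  then have "(\<Sum>t\<in>UNIV. c $ t + \<epsilon>) \<le> real (resources G)"
    using n by (simp add: sum.distrib n_def field_simps)
  ultimately show "(\<chi> t. c $ t + \<epsilon>) \<in> defender_strategies G"
    using c(1) pos by (simp add: defender_strategies_def add_nonneg_nonneg)
qed

lemma minimax_strategy_ge_threshold:
  assumes "security_game G" "minimax_strategy G c"
  shows "(att_unc G t - E_star G) / (att_unc G t - att_cov G t) \<le> c $ t"
  using assms U_a_axis_le_E [of G c t]
  by (simp add: security_game_def minimax_strategy_def U_a_axis_eq_diff divide_le_eq)

text \<open>\<open>m\<close> is the least nonnegative coverage that keeps every attacker utility at
  or below \<open>E_star G\<close>, so it lies coordinatewise below every minimax strategy. As
  \<open>m\<close> already exhausts the resources, nothing can lie strictly above it.\<close>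

lemma minimax_strategy_eq_threshold:
  assumes G: "security_game G" and ne: "\<And>t. att_cov G t \<noteq> E_star G"
  defines "m \<equiv> (\<chi> t. max 0 ((att_unc G t - E_star G) / (att_unc G t - att_cov G t)))"
  shows "minimax_strategy G c \<longleftrightarrow> c = m"
    and "(\<Sum>t\<in>UNIV. m $ t) = real (resources G)"
proof -
  have \<Delta>: "att_unc G t - att_cov G t > 0" for t using G by (simp add: security_game_def)
  obtain c0 where c0: "minimax_strategy G c0"
    using E_star_attained [of G] by (auto simp: minimax_strategy_def)
  have ge: "m $ t \<le> c $ t" if "minimax_strategy G c" for c t
    using minimax_strategy_ge_threshold [OF G that] that
    by (simp add: m_def minimax_strategy_def defender_strategies_def)
  have "c0 $ t \<le> 1" for t
    using c0 by (simp add: minimax_strategy_def defender_strategies_def)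
  then have "c0 $ t * (att_unc G t - att_cov G t) \<le> 1 * (att_unc G t - att_cov G t)" for t
    using \<Delta> [of t] by (intro mult_right_mono) auto
  then have "att_cov G t \<le> E_star G" for t
    using U_a_axis_le_E [of G c0 t] c0 unfolding U_a_axis_eq_diff minimax_strategy_def
    by (smt (verit) mult_1)
  \<comment> \<open>Here \<open>ne\<close> enters: strictness puts the threshold below full
    coverage, leaving room to raise every coordinate of \<open>m\<close>.\<close>
  then have "att_cov G t < E_star G" for t using ne [of t] by (simp add: order_less_le)
  then have m1: "m $ t < 1" for t using \<Delta> [of t] by (simp add: m_def divide_less_eq)
  \<comment> \<open>The resource bound for \<open>m\<close> is inherited from the minimax strategy
    \<open>c0\<close> above it.\<close>
  have "(\<Sum>t\<in>UNIV. m $ t) \<le> (\<Sum>t\<in>UNIV. c0 $ t)" by (intro sum_mono ge c0)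
  then have mD: "m \<in> defender_strategies G"
    using c0 m1 by (auto simp: minimax_strategy_def defender_strategies_def m_def less_imp_le)
  have u: "U_a G m (axis t 1) \<le> E_star G" for t
  proof -
    have "(att_unc G t - E_star G) / (att_unc G t - att_cov G t) \<le> m $ t" by (simp add: m_def)
    with \<Delta> [of t] show ?thesis by (simp add: U_a_axis_eq_diff divide_le_eq)
  qed
  then have "E G m \<le> E_star G" by (metis E_attained)
  with mD E_star_le [OF mD] have mm: "minimax_strategy G m"
    by (simp add: minimax_strategy_def)
  show sum: "(\<Sum>t\<in>UNIV. m $ t) = real (resources G)"
  proof (rule ccontr)
    assume "\<not> ?thesis"
    with mD have "(\<Sum>t\<in>UNIV. m $ t) < real (resources G)"
      by (simp add: defender_strategies_def)
    from exists_strictly_larger_strategy [OF mD m1 this]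
    obtain c' where c': "c' \<in> defender_strategies G" "\<And>t. m $ t < c' $ t" by blast
    obtain t where "U_a G c' (axis t 1) = E G c'" by (rule E_attained)
    moreover have "U_a G c' (axis t 1) < U_a G m (axis t 1)"
      using \<Delta> [of t] c'(2) [of t] by (simp add: U_a_axis_eq_diff)
    ultimately show False using u [of t] E_star_le [OF c'(1)] by simp
  qed
  show "minimax_strategy G c \<longleftrightarrow> c = m"
  proof
    assume c: "minimax_strategy G c"
    then have "(\<Sum>t\<in>UNIV. c $ t) \<le> (\<Sum>t\<in>UNIV. m $ t)"
      using sum by (simp add: minimax_strategy_def defender_strategies_def)
    then have "(\<Sum>t\<in>UNIV. c $ t - m $ t) = 0"
      using sum_mono [of UNIV "\<lambda>t. m $ t" "\<lambda>t. c $ t"] ge [OF c]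
      by (simp add: sum_subtractf order_antisym)
    then have "\<forall>t. c $ t - m $ t = 0"
      using ge [OF c] by (subst (asm) sum_nonneg_eq_0_iff) auto
    then show "c = m" by (simp add: vec_eq_iff)
  qed (simp add: mm)
qed

text \<open>Positive coverage excludes the value 0 of the maximum, and the remaining quotient is
  exactly the coverage at which the attacker obtains \<open>E_star G\<close>.\<close>

lemma minimax_strategy_properties:
  assumes "security_game G" "\<And>t. att_cov G t \<noteq> E_star G" "minimax_strategy G c"
  shows "(\<Sum>t\<in>UNIV. c $ t) = real (resources G)"
    and "c $ t > 0 \<Longrightarrow> U_a G c (axis t 1) = E_star G"
proof -
  note c = minimax_strategy_eq_threshold [OF assms(1,2)]
  show "(\<Sum>t\<in>UNIV. c $ t) = real (resources G)" using c assms(3) by simp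
  assume "c $ t > 0"
  moreover have "c $ t = max 0 ((att_unc G t - E_star G) / (att_unc G t - att_cov G t))"
    using c(1) assms(3) by simp
  ultimately have "c $ t = (att_unc G t - E_star G) / (att_unc G t - att_cov G t)"
    by (auto simp: max_def split: if_splits)
  moreover have "att_unc G t - att_cov G t \<noteq> 0"
    using assms(1) by (metis less_irrefl security_game_def)
  ultimately show "U_a G c (axis t 1) = E_star G" by (simp add: U_a_axis_eq_diff)
qed

section \<open>The minimax strategy against other strategies, and the equilibria\<close>

lemma minimax_strategy_dominates_on_best_responses:
  assumes G: "security_game G" and ne: "\<And>t. att_cov G t \<noteq> E_star G"
    and c: "minimax_strategy G c"
    and c': "c' \<in> defender_strategies G" "c' \<noteq> c"
    and a: "attacker_best_response G c' a"
  shows "attacker_best_response G c a" and "U_d G c' a < U_d G c a"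
proof -
  have "\<not> minimax_strategy G c'"
    using c c'(2) minimax_strategy_eq_threshold(1) [OF G ne] by metis
  then have gt: "E_star G < E G c'"
    using c'(1) E_star_le [OF c'(1)] by (auto simp: minimax_strategy_def)
  have less: "c' $ t < c $ t" if "a $ t \<noteq> 0" for t
  proof -
    have "U_a G c (axis t 1) < U_a G c' (axis t 1)"
      using a that gt c U_a_axis_le_E [of G c t]
      by (simp add: attacker_best_response_iff_support minimax_strategy_def)
    moreover have "att_unc G t - att_cov G t > 0" using G by (simp add: security_game_def)
    ultimately show ?thesis by (simp add: U_a_axis_eq_diff)
  qed
  \<comment> \<open>Since \<open>c'\<close> is nonnegative, strictly larger coverage is positive,
    and positively covered targets lie in the attack set of \<open>c\<close>.\<close>
  have "c $ t > 0" if "a $ t \<noteq> 0" for t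
    using less [OF that] c'(1) by (auto simp: defender_strategies_def intro: le_less_trans)
  then have "U_a G c (axis t 1) = E G c" if "a $ t \<noteq> 0" for t
    using minimax_strategy_properties(2) [OF G ne c] c that by (simp add: minimax_strategy_def)
  with a show "attacker_best_response G c a" by (simp add: attacker_best_response_iff_support)
  have aS: "a \<in> attacker_strategies" using a by (simp add: attacker_best_response_def)
  have pos: "0 < a $ t * (c $ t - c' $ t) * (def_cov G t - def_unc G t)" if "a $ t \<noteq> 0" for t
  proof -
    have "0 < a $ t" using aS that by (simp add: attacker_strategies_def order_less_le)
    then show ?thesis using less [OF that] G by (simp add: security_game_def)
  qed
  obtain s where "a $ s > 0" using aS by (rule attacker_strategies_obtain_support)
  then have "0 < (\<Sum>t\<in>UNIV. a $ t * (c $ t - c' $ t) * (def_cov G t - def_unc G t))"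
    using pos by (intro sum_pos2 [of _ s]) (auto, metis less_imp_le mult_zero_left order_refl)
  then show "U_d G c' a < U_d G c a" unfolding U_d_diff [symmetric] by simp
qed

lemma minimax_strategy_imp_defender_NE_strategy:
  assumes G: "security_game G" and ne: "\<And>t. att_cov G t \<noteq> E_star G"
    and c: "minimax_strategy G c"
  shows "defender_NE_strategy G c"
proof -
  define M where "M = {t. U_a G c (axis t 1) = E G c}"
  \<comment> \<open>After normalization, \<open>a $ t * (def_cov G t - def_unc G t)\<close> equals
    \<open>1 / sum w UNIV\<close> on all of \<open>M\<close>: each unit of coverage there is worth
    the same to the defender.\<close>
  define w where "w t = (if t \<in> M then 1 / (def_cov G t - def_unc G t) else 0)" for t
  define a :: "real ^ 'a" where "a = (\<chi> t. w t / sum w UNIV)"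
  have \<Delta>: "def_cov G t - def_unc G t > 0" for t using G by (simp add: security_game_def)
  have w: "w t \<ge> 0" for t using \<Delta> [of t] by (simp add: w_def)
  obtain s where "s \<in> M" using E_attained [of G c] by (auto simp: M_def)
  with \<Delta> [of s] have "w s > 0" by (simp add: w_def)
  then have W: "sum w UNIV > 0" using w by (intro sum_pos2 [of _ s]) auto
  have "(\<Sum>t\<in>UNIV. a $ t) = sum w UNIV / sum w UNIV"
    by (simp add: a_def flip: sum_divide_distrib)
  with W w have aS: "a \<in> attacker_strategies"
    by (simp add: attacker_strategies_def) (simp add: a_def)
  then have "attacker_best_response G c a"
    by (auto simp: attacker_best_response_iff_support a_def w_def M_def split: if_splits)
  moreover have "U_d G c' a \<le> U_d G c a" if c': "c' \<in> defender_strategies G" for c'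
  proof -
    have supp: "c $ t \<le> 0" if "t \<notin> M" for t
      using minimax_strategy_properties(2) [OF G ne c, of t] c that
      by (force simp: M_def minimax_strategy_def)
    \<comment> \<open>Equality holds on \<open>M\<close>. Off \<open>M\<close> the right side is 0,
      while the left is nonnegative because \<open>c\<close> spends nothing there. Summing bounds
      the gain by the difference in total coverage, which is at most 0 as \<open>c\<close> uses all
      resources.\<close>
    have "(c' $ t - c $ t) / sum w UNIV
        \<ge> a $ t * (c' $ t - c $ t) * (def_cov G t - def_unc G t)" for t
    proof (cases "t \<in> M")
      case True
      then show ?thesis using \<Delta> [of t] by (simp add: a_def w_def)
    next
      case False
      have "0 \<le> c' $ t" using c' by (simp add: defender_strategies_def)
      with supp [OF False] W False show ?thesis by (simp add: a_def w_def)
    qed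
    then have "U_d G c' a - U_d G c a \<le> (\<Sum>t\<in>UNIV. (c' $ t - c $ t) / sum w UNIV)"
      unfolding U_d_diff by (intro sum_mono)
    also have "\<dots> = ((\<Sum>t\<in>UNIV. c' $ t) - (\<Sum>t\<in>UNIV. c $ t)) / sum w UNIV"
      by (simp add: sum_subtractf flip: sum_divide_distrib)
    also have "\<dots> \<le> 0"
      using c' W minimax_strategy_properties(1) [OF G ne c]
      by (simp add: defender_strategies_def divide_le_0_iff)
    finally show ?thesis by simp
  qed
  ultimately show ?thesis using c
    by (auto simp: defender_NE_strategy_def nash_equilibrium_def defender_best_response_def
        minimax_strategy_def)
qed

lemma minimax_strategy_iff_defender_NE_strategy:
  assumes G: "security_game G" and ne: "\<And>t. att_cov G t \<noteq> E_star G"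
  shows "minimax_strategy G c \<longleftrightarrow> defender_NE_strategy G c"
proof
  assume "defender_NE_strategy G c"
  then obtain a where a: "defender_best_response G a c" "attacker_best_response G c a"
    by (auto simp: defender_NE_strategy_def nash_equilibrium_def)
  obtain m where m: "minimax_strategy G m"
    using minimax_strategy_eq_threshold(1) [OF G ne] by blast
  have "c = m"
  proof (rule ccontr)
    assume "c \<noteq> m"
    then have "U_d G c a < U_d G m a"
      using a minimax_strategy_dominates_on_best_responses(2) [OF G ne m]
      by (simp add: defender_best_response_def)
    moreover have "U_d G m a \<le> U_d G c a"
      using a(1) m by (simp add: defender_best_response_def minimax_strategy_def)
    ultimately show False by simp
  qed
  with m show "minimax_strategy G c" by simp
qed (rule minimax_strategy_imp_defender_NE_strategy [OF G ne])

lemma minimax_strategy_iff_defender_SSE_strategy: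
  assumes G: "security_game G" and ne: "\<And>t. att_cov G t \<noteq> E_star G"
  shows "minimax_strategy G c \<longleftrightarrow> defender_SSE_strategy G c"
proof
  assume c: "minimax_strategy G c"
  obtain g where g: "\<And>c'. attacker_best_response G c' (g c')"
    "\<And>c' a. attacker_best_response G c' a \<Longrightarrow> U_d G c' a \<le> U_d G c' (g c')"
    using exists_favourable_best_response [of G] by metis
  have "U_d G c' (g c') \<le> U_d G c (g c)" if "c' \<in> defender_strategies G" for c'
  proof (cases "c' = c")
    case False
    \<comment> \<open>The response \<open>g c'\<close> is also a best response to \<open>c\<close>,
      so \<open>U_d G c' (g c') < U_d G c (g c') \<le> U_d G c (g c)\<close>.\<close>
    note minimax_strategy_dominates_on_best_responses [OF G ne c that False g(1)]
    then show ?thesis using g(2) [of c "g c'"] by simp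
  qed simp
  with c g have "strong_stackelberg_equilibrium G c g"
    by (simp add: strong_stackelberg_equilibrium_def minimax_strategy_def)
  then show "defender_SSE_strategy G c" by (auto simp: defender_SSE_strategy_def)
next
  assume "defender_SSE_strategy G c"
  then obtain g where g: "strong_stackelberg_equilibrium G c g"
    by (auto simp: defender_SSE_strategy_def)
  obtain m where m: "minimax_strategy G m"
    using minimax_strategy_eq_threshold(1) [OF G ne] by blast
  have mD: "m \<in> defender_strategies G" using m by (simp add: minimax_strategy_def)
  have "c = m"
  proof (rule ccontr)
    assume "c \<noteq> m"
    moreover have "c \<in> defender_strategies G" "attacker_best_response G c (g c)"
      using g by (auto simp: strong_stackelberg_equilibrium_def)
    \<comment> \<open>Tie-breaking at \<open>m\<close> and optimality of \<open>c\<close> close the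
      contradictory cycle \<open>U_d G c (g c) < U_d G m (g c) \<le> U_d G m (g m) \<le> U_d G c (g
      c)\<close>.\<close>
    ultimately have "attacker_best_response G m (g c)" "U_d G c (g c) < U_d G m (g c)"
      using minimax_strategy_dominates_on_best_responses [OF G ne m] by auto
    moreover have "U_d G m a \<le> U_d G m (g m)" if "attacker_best_response G m a" for a
      using g mD that by (simp add: strong_stackelberg_equilibrium_def)
    moreover have "U_d G m (g m) \<le> U_d G c (g c)"
      using g mD by (simp add: strong_stackelberg_equilibrium_def)
    ultimately show False by fastforce
  qed
  with m show "minimax_strategy G c" by simp
qed

theorem theorem3p10:
  fixes G :: "'t::finite game"
  assumes "security_game G"
    and "\<And>t. att_cov G t \<noteq> E_star G"
  shows "(\<exists>!c. minimax_strategy G c) \<and>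
         (\<exists>!c. defender_NE_strategy G c) \<and>
         (\<exists>!c. defender_SSE_strategy G c) \<and>
         (\<forall>c. minimax_strategy G c \<longleftrightarrow> defender_NE_strategy G c) \<and>
         (\<forall>c. defender_NE_strategy G c \<longleftrightarrow> defender_SSE_strategy G c)"
proof -
  have "\<exists>!c. minimax_strategy G c"
    unfolding minimax_strategy_eq_threshold(1) [OF assms] by simp
  then show ?thesis
    using minimax_strategy_iff_defender_NE_strategy [OF assms]
      minimax_strategy_iff_defender_SSE_strategy [OF assms] by simp
qed

end
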